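(* Let $k\ge 2$ and let $t$ be a positive integer with $t<k$. If $S$ is a $k$-family with matching number $M_S>t$ and Laplacian eigenvalues $\lambda_1\ge\lambda_2\ge\cdots$, then $$\sum_{i=1}^t\lambda_i \le (k-1)f_{k-1}(S)+\binom{t+k-1}{k}.$$
   Context: A $k$-family on vertex set $[n]$ is a pure $(k-1)$-dimensional abstract simplicial complex, determined by a nonempty set of $k$-element subsets of $[n]$ (its facets); $f_{k-1}(S)$ is the number of facets. Let $\partial_{k-1}$ be the matrix with rows indexed by the $(k-1)$-element subsets of $[n]$ and columns by the facets, with entry $(-1)^j$ in row $G$, column $F=\{v_0<\cdots<v_{k-1}\}$ if $G=F\setminus\{v_j\}$, and $0$ otherwise. The Laplacian is $L(S)=\partial_{k-1}\partial_{k-1}^T$ with eigenvalues $\lambda_1\ge\lambda_2\ge\cdots\ge0$; set $\lambda_i=0$ beyond the matrix size. The ridge graph of $S$ has one vertex per facet, two facets adjacent iff they share $k-1$ elements. A matching in $S$ is a set of facets forming an independent set in the ridge graph; the matching number $M_S$ is the maximum size of such an independent set. *)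

theory Defs
  imports
    "Jordan_Normal_Form.Char_Poly"
    "HOL-Library.Multiset"
begin

text \<open>
  The vertex set \<open>[n]\<close> is \<open>{1..n}\<close>. A \<open>k\<close>-family is determined by its facets and is represented by
  the set \<open>S\<close> of its facets; thus its number of facets is \<^term>\<open>card S\<close>.
\<close>

definition k_family :: "nat \<Rightarrow> nat \<Rightarrow> nat set set \<Rightarrow> bool" where
  "k_family n k S \<longleftrightarrow> S \<noteq> {} \<and> (\<forall>F\<in>S. F \<subseteq> {1..n} \<and> card F = k)"

definition subset_list :: "nat \<Rightarrow> nat set list" where
  "subset_list n = map set (subseqs [1..<Suc n])"

definition ridge_list :: "nat \<Rightarrow> nat \<Rightarrow> nat set list" where
  "ridge_list n k = filter (\<lambda>G. card G = k - 1) (subset_list n)"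

definition facet_list :: "nat \<Rightarrow> nat set set \<Rightarrow> nat set list" where
  "facet_list n S = filter (\<lambda>F. F \<in> S) (subset_list n)"

text \<open>For finite \<open>F\<close>, the list \<^term>\<open>sorted_list_of_set F\<close> is \<open>[v\<^sub>0, v\<^sub>1, \<dots>]\<close> in strictly
  increasing order.\<close>

definition boundary_entry :: "nat set \<Rightarrow> nat set \<Rightarrow> real" where
  "boundary_entry G F =
    (if \<exists>j<card F. G = F - {sorted_list_of_set F ! j}
     then (-1) ^ (THE j. j < card F \<and> G = F - {sorted_list_of_set F ! j})
     else 0)"

definition boundary_mat :: "nat \<Rightarrow> nat \<Rightarrow> nat set set \<Rightarrow> real mat" where
  "boundary_mat n k S =
    mat (length (ridge_list n k)) (length (facet_list n S))
      (\<lambda>(i, j). boundary_entry (ridge_list n k ! i) (facet_list n S ! j))"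

definition laplacian :: "nat \<Rightarrow> nat \<Rightarrow> nat set set \<Rightarrow> real mat" where
  "laplacian n k S = boundary_mat n k S * transpose_mat (boundary_mat n k S)"

text \<open>
  The real roots of the characteristic polynomial, with multiplicity and in decreasing order.
  For a real symmetric matrix, such as the Laplacian, these are all of its eigenvalues.
\<close>

definition eigenvalue_list :: "real mat \<Rightarrow> real list" where
  "eigenvalue_list A = rev (sorted_list_of_multiset (proots (char_poly A)))"

text \<open>Indexing starts at 1; only indices \<open>i \<ge> 1\<close> are meaningful.\<close>

definition laplacian_eigenvalue :: "nat \<Rightarrow> nat \<Rightarrow> nat set set \<Rightarrow> nat \<Rightarrow> real" where
  "laplacian_eigenvalue n k S i =
    (let ls = eigenvalue_list (laplacian n k S)
     in if i \<le> length ls then ls ! (i - 1) else 0)"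

definition ridge_adjacent :: "nat \<Rightarrow> nat set \<Rightarrow> nat set \<Rightarrow> bool" where
  "ridge_adjacent k F F' \<longleftrightarrow> F \<noteq> F' \<and> card (F \<inter> F') = k - 1"

definition is_matching :: "nat \<Rightarrow> nat set set \<Rightarrow> nat set set \<Rightarrow> bool" where
  "is_matching k S M \<longleftrightarrow> M \<subseteq> S \<and> (\<forall>F\<in>M. \<forall>F'\<in>M. \<not> ridge_adjacent k F F')"

definition matching_number :: "nat \<Rightarrow> nat set set \<Rightarrow> nat" where
  "matching_number k S = Max {card M | M. is_matching k S M}"

end

theory Submission
  imports
    Defs
    "Jordan_Normal_Form.Schur_Decomposition"
    "HOL-Analysis.Convex"
begin

text \<open>
  Let \<open>f\<close> be the number of facets, \<open>\<partial>\<close> the boundary matrix and \<open>C\<close> the binomial coefficient in the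
  claim. The Gram matrix \<open>\<partial>\<^sup>T\<partial>\<close> is an \<open>f \<times> f\<close> matrix with diagonal entries \<open>k\<close> and off-diagonal
  entries in \<open>{-1, 0, 1}\<close>, and it has the same nonzero spectrum and the same Frobenius norm as
  \<open>L = \<partial>\<partial>\<^sup>T\<close>. Hence the squares of all eigenvalues of \<open>L\<close> add up to at most \<open>f (k\<^sup>2 + f - 1)\<close>, and
  by Cauchy-Schwarz the square of the sum of any \<open>t\<close> of them is at most \<open>t f (k\<^sup>2 + f - 1)\<close>. Now
  \<open>((k - 1) f + C)\<^sup>2 - t f (k\<^sup>2 + f - 1) = ((k - 1)\<^sup>2 - t) f\<^sup>2 + (k - 1) (2 C - t (k + 1)) f + C\<^sup>2\<close>,
  where every coefficient is nonnegative as soon as \<open>2 \<le> t < k\<close>. For \<open>t = 1\<close> the middle coefficient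
  is negative; there the largest eigenvalue is bounded by the maximal absolute row sum \<open>k + f - 1\<close>
  of \<open>\<partial>\<^sup>T\<partial>\<close>.
\<close>

section \<open>Traces and eigenvalues of real symmetric matrices\<close>

definition mat_trace :: "'a :: comm_semiring_0 mat \<Rightarrow> 'a" where
  "mat_trace A = (\<Sum>i<dim_row A. A $$ (i, i))"

lemma index_mult_mat_sum:
  assumes "A \<in> carrier_mat n m" "B \<in> carrier_mat m p" "i < n" "j < p"
  shows "(A * B) $$ (i, j) = (\<Sum>l<m. A $$ (i, l) * B $$ (l, j))"
proof -
  have "(A * B) $$ (i, j) = (\<Sum>l = 0..<m. A $$ (i, l) * B $$ (l, j))"
    using assms by (simp add: scalar_prod_def)
  then show ?thesis by (simp add: atLeast0LessThan)
qed

lemma index_mult_mat_vec_sum: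
  assumes "A \<in> carrier_mat n m" "v \<in> carrier_vec m" "i < n"
  shows "(A *\<^sub>v v) $ i = (\<Sum>l<m. A $$ (i, l) * v $ l)"
proof -
  have "(A *\<^sub>v v) $ i = (\<Sum>l = 0..<m. A $$ (i, l) * v $ l)"
    using assms by (simp add: scalar_prod_def)
  then show ?thesis by (simp add: atLeast0LessThan)
qed

lemma mat_trace_mult_commute:
  assumes A: "A \<in> carrier_mat n m" and B: "B \<in> carrier_mat m n"
  shows "mat_trace (A * B) = mat_trace (B * A)"
proof -
  have "mat_trace (A * B) = (\<Sum>i<n. \<Sum>l<m. A $$ (i, l) * B $$ (l, i))"
    using A B unfolding mat_trace_def
    by (intro sum.cong) (auto simp: index_mult_mat_sum[OF A B] simp del: index_mult_mat(1))
  also have "\<dots> = (\<Sum>l<m. \<Sum>i<n. B $$ (l, i) * A $$ (i, l))"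
    by (subst sum.swap) (simp add: mult.commute)
  also have "\<dots> = mat_trace (B * A)"
    using A B unfolding mat_trace_def
    by (intro sum.cong) (auto simp: index_mult_mat_sum[OF B A] simp del: index_mult_mat(1))
  finally show ?thesis .
qed

lemma mat_trace_similar:
  fixes A :: "'a :: comm_ring_1 mat"
  assumes "similar_mat A B"
  shows "mat_trace A = mat_trace B"
proof -
  from similar_matD[OF assms] obtain n P Q where
    carr: "{A, B, P, Q} \<subseteq> carrier_mat n n" and QP: "Q * P = 1\<^sub>m n" and A: "A = P * B * Q"
    by auto
  have "mat_trace A = mat_trace (Q * (P * B))"
    unfolding A using carr by (intro mat_trace_mult_commute[of _ n n]) auto
  also have "Q * (P * B) = (Q * P) * B"
    using carr by (intro assoc_mult_mat[symmetric, of _ n n _ n _ n]) auto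
  also have "\<dots> = B" unfolding QP using carr by (intro left_mult_one_mat) auto
  finally show ?thesis .
qed

lemma mat_trace_square_symmetric:
  fixes A :: "real mat"
  assumes A: "A \<in> carrier_mat n n" and sym: "transpose_mat A = A"
  shows "mat_trace (A * A) = (\<Sum>i<n. \<Sum>j<n. (A $$ (i, j))\<^sup>2)"
proof -
  have "A $$ (j, i) = A $$ (i, j)" if "i < n" "j < n" for i j
    using A that by (subst sym[symmetric]) simp
  then show ?thesis
    using A unfolding mat_trace_def
    by (auto simp: index_mult_mat_sum[OF A A] power2_eq_square simp del: index_mult_mat(1)
        intro!: sum.cong)
qed

text \<open>In the product \<open>A $$ (i, l) * A $$ (l, i)\<close> one factor lies below the
  diagonal unless \<open>l = i\<close>.\<close>

lemma upper_triangular_square_diag: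
  fixes A :: "'a :: comm_ring_1 mat"
  assumes A: "A \<in> carrier_mat n n" and ut: "upper_triangular A" and i: "i < n"
  shows "(A * A) $$ (i, i) = (A $$ (i, i))\<^sup>2"
proof -
  have "A $$ (i, l) * A $$ (l, i) = 0" if "l < n" "l \<noteq> i" for l
  proof (cases "l < i")
    case True
    then show ?thesis using A ut i upper_triangularD[of A l i] by auto
  next
    case False
    then show ?thesis using A ut that upper_triangularD[of A i l] by auto
  qed
  then have "(\<Sum>l<n. A $$ (i, l) * A $$ (l, i)) = (\<Sum>l\<in>{i}. A $$ (i, l) * A $$ (l, i))"
    using i by (intro sum.mono_neutral_right) auto
  then show ?thesis
    unfolding index_mult_mat_sum[OF A A i i] by (simp add: power2_eq_square)
qed

text \<open>The Hermitian form of an eigenvector is its own conjugate, and it also equals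
  \<open>e\<close> times the positive squared norm of that vector.\<close>

lemma symmetric_complex_eigenvalue_real:
  fixes A :: "real mat"
  assumes A: "A \<in> carrier_mat n n" and sym: "transpose_mat A = A"
    and ev: "eigenvalue (map_mat complex_of_real A) e"
  shows "e \<in> \<real>"
proof -
  let ?A = "map_mat complex_of_real A"
  have cA: "?A \<in> carrier_mat n n" using A by simp
  from ev obtain v where v: "v \<in> carrier_vec n" "v \<noteq> 0\<^sub>v n" and Av: "?A *\<^sub>v v = e \<cdot>\<^sub>v v"
    unfolding eigenvalue_def eigenvector_def using A by auto
  define s where "s = (\<Sum>i<n. \<Sum>j<n. complex_of_real (A $$ (i, j)) * v $ j * cnj (v $ i))"
  define q where "q = (\<Sum>i<n. (cmod (v $ i))\<^sup>2)"
  have symm: "A $$ (j, i) = A $$ (i, j)" if "i < n" "j < n" for i j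
    using A that by (subst sym[symmetric]) simp
  have "s = (\<Sum>i<n. (\<Sum>j<n. ?A $$ (i, j) * v $ j) * cnj (v $ i))"
    unfolding s_def sum_distrib_right using A by (intro sum.cong) auto
  also have "\<dots> = (\<Sum>i<n. (e * v $ i) * cnj (v $ i))"
  proof (intro sum.cong refl)
    fix i assume "i \<in> {..<n}"
    then have i: "i < n" by simp
    show "(\<Sum>j<n. ?A $$ (i, j) * v $ j) * cnj (v $ i) = (e * v $ i) * cnj (v $ i)"
      using arg_cong[OF Av, of "\<lambda>w. w $ i"] i v
      unfolding index_mult_mat_vec_sum[OF cA v(1) i] by simp
  qed
  also have "\<dots> = e * of_real q"
    unfolding q_def of_real_sum sum_distrib_left
    by (intro sum.cong) (auto simp: complex_norm_square[symmetric] mult.assoc)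
  finally have s: "s = e * of_real q" .
  \<comment> \<open>Conjugation fixes the real entries of \<open>A\<close> and swaps the roles of
    \<open>i\<close> and \<open>j\<close>; symmetry of \<open>A\<close> undoes the swap.\<close>
  have "cnj s = (\<Sum>i<n. \<Sum>j<n. complex_of_real (A $$ (i, j)) * cnj (v $ j) * v $ i)"
    unfolding s_def by simp
  also have "\<dots> = s"
    unfolding s_def by (subst sum.swap) (auto intro!: sum.cong simp: symm mult_ac)
  finally have "s \<in> \<real>" by (simp add: Reals_cnj_iff)
  moreover have "q \<noteq> 0"
  proof
    assume "q = 0"
    then have "\<forall>i<n. v $ i = 0" unfolding q_def by (subst (asm) sum_nonneg_eq_0_iff) auto
    then have "v = 0\<^sub>v n" using v by (intro eq_vecI) auto
    with v show False by simp
  qed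
  then have "e = s / of_real q" using s by simp
  ultimately show ?thesis by simp
qed

text \<open>Over the complex numbers the polynomial factors, and all roots are real. Replacing each
  root by its real part thus changes nothing, and the factorization descends along the injective
  embedding of the reals.\<close>

lemma symmetric_char_poly_splits:
  fixes A :: "real mat"
  assumes A: "A \<in> carrier_mat n n" and sym: "transpose_mat A = A"
  shows "\<exists>rs. char_poly A = (\<Prod>r\<leftarrow>rs. [:- r, 1:])"
proof -
  let ?A = "map_mat complex_of_real A"
  have cA: "?A \<in> carrier_mat n n" using A by simp
  obtain es where es: "char_poly ?A = (\<Prod>e\<leftarrow>es. [:- e, 1:])"
    using char_poly_factorized[OF cA] by blast
  have real: "e \<in> \<real>" if "e \<in> set es" for e
  proof -
    have "poly (char_poly ?A) e = 0"
      unfolding es using that by (auto simp: poly_prod_list prod_list_zero_iff image_iff)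
    then show ?thesis
      using symmetric_complex_eigenvalue_real[OF A sym] eigenvalue_root_char_poly[OF cA] by blast
  qed
  interpret mp: map_poly_inj_comm_ring_hom complex_of_real
    by unfold_locales auto
  have "map_poly complex_of_real (\<Prod>r\<leftarrow>map Re es. [:- r, 1:]) = (\<Prod>e\<leftarrow>es. [:- e, 1:])"
    using real
  proof (induction es)
    case (Cons e es)
    then have "map_poly complex_of_real [:- Re e, 1:] = [:- e, 1:]"
      by (simp add: complex_is_Real_iff complex_eq_iff)
    with Cons show ?case by (simp add: mp.hom_mult del: mult_pCons_left)
  qed simp
  then have "map_poly complex_of_real (\<Prod>r\<leftarrow>map Re es. [:- r, 1:])
      = map_poly complex_of_real (char_poly A)"
    unfolding es[symmetric] by (simp only: of_real_hom.char_poly_hom[OF A])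
  then show ?thesis by (metis mp.injectivity)
qed

text \<open>Since the characteristic polynomial splits over the reals, \<open>proots\<close>
  captures the whole diagonal of a real Schur form \<open>B\<close>. That diagonal squared is the
  diagonal of \<open>B * B\<close>, and the trace is invariant under similarity.\<close>

lemma sum_squares_eigenvalue_list:
  fixes A :: "real mat"
  assumes A: "A \<in> carrier_mat n n" and sym: "transpose_mat A = A"
  shows "(\<Sum>x\<leftarrow>eigenvalue_list A. x\<^sup>2) = mat_trace (A * A)"
proof -
  obtain rs where rs: "char_poly A = (\<Prod>r\<leftarrow>rs. [:- r, 1:])"
    using symmetric_char_poly_splits[OF A sym] by blast
  obtain B where B: "B \<in> carrier_mat n n" and ut: "upper_triangular B" and sim: "similar_mat A B"
    using schur_decomposition_exists[OF A rs] by blast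
  have "char_poly A = (\<Prod>b\<leftarrow>diag_mat B. [:- b, 1:])"
    using char_poly_similar[OF sim] char_poly_upper_triangular[OF B ut] by simp
  moreover have "proots (\<Prod>b\<leftarrow>bs. [:- b, 1:]) = mset bs" for bs :: "real list"
  proof (induction bs)
    case (Cons b bs)
    have "(\<Prod>b\<leftarrow>bs. [:- b, 1:]) \<noteq> 0" by (auto simp: prod_list_zero_iff)
    with Cons show ?case by (simp add: proots_mult del: mult_pCons_left)
  qed simp
  ultimately have "mset (eigenvalue_list A) = mset (diag_mat B)"
    unfolding eigenvalue_list_def by simp
  then have "mset (map (\<lambda>x. x\<^sup>2) (eigenvalue_list A)) = mset (map (\<lambda>x. x\<^sup>2) (diag_mat B))"
    by simp
  then have "(\<Sum>x\<leftarrow>eigenvalue_list A. x\<^sup>2) = (\<Sum>x\<leftarrow>diag_mat B. x\<^sup>2)"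
    by (metis sum_mset_sum_list)
  also have "\<dots> = (\<Sum>i<n. (B $$ (i, i))\<^sup>2)"
    using B by (simp add: diag_mat_def comp_def sum_list_sum_nth atLeast0LessThan)
  also have "\<dots> = mat_trace (B * B)"
    using B unfolding mat_trace_def
    by (auto simp: upper_triangular_square_diag[OF B ut] simp del: index_mult_mat(1))
  also have "\<dots> = mat_trace (A * A)"
  proof -
    obtain P Q where "similar_mat_wit A B P Q" using sim unfolding similar_mat_def by blast
    \<comment> \<open>Similarity passes to squares because the same witnesses serve for every
      power.\<close>
    from similar_mat_wit_pow[OF this, of 2] have "similar_mat (A ^\<^sub>m 2) (B ^\<^sub>m 2)"
      unfolding similar_mat_def by blast
    then have "similar_mat (A * A) (B * B)" using A B by (simp add: numeral_2_eq_2)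
    from mat_trace_similar[OF this] show ?thesis by simp
  qed
  finally show ?thesis .
qed

section \<open>Gram matrices and eigenvalue bounds from row sums\<close>

text \<open>Cyclicity of the trace moves the leading \<open>D\<close> to the end. This passes from a
  matrix indexed by ridges to one indexed by facets, whose entries are easy to bound.\<close>

lemma mat_trace_gram_square:
  fixes D :: "real mat"
  assumes D: "D \<in> carrier_mat m n"
  shows "mat_trace ((D * transpose_mat D) * (D * transpose_mat D))
    = (\<Sum>i<n. \<Sum>j<n. ((transpose_mat D * D) $$ (i, j))\<^sup>2)"
proof -
  let ?T = "transpose_mat D"
  have T: "?T \<in> carrier_mat n m" using D by simp
  have "(D * ?T) * (D * ?T) = D * (?T * (D * ?T))"
    using D T by (intro assoc_mult_mat[of _ m n _ m _ m]) auto
  then have "mat_trace ((D * ?T) * (D * ?T)) = mat_trace ((?T * (D * ?T)) * D)"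
    using D T mat_trace_mult_commute[of D m n "?T * (D * ?T)"] by simp
  also have "(?T * (D * ?T)) * D = (?T * D) * (?T * D)"
  proof -
    have "?T * (D * ?T) = (?T * D) * ?T"
      using D T by (intro assoc_mult_mat[symmetric, of _ n m _ n _ m]) auto
    then show ?thesis
      using D T assoc_mult_mat[of "?T * D" n n ?T m D n] by simp
  qed
  also have "mat_trace ((?T * D) * (?T * D)) = (\<Sum>i<n. \<Sum>j<n. ((?T * D) $$ (i, j))\<^sup>2)"
    using D T by (intro mat_trace_square_symmetric) (auto simp: transpose_mult[of _ n m _ n])
  finally show ?thesis .
qed

text \<open>An eigenvector \<open>v\<close> is sent to \<open>transpose_mat D *\<^sub>v v\<close>.
  The image is nonzero because \<open>D\<close> maps it to \<open>e\<close> times \<open>v\<close>,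
  and \<open>e\<close> is nonzero.\<close>

lemma eigenvalue_gram_transpose:
  fixes D :: "real mat"
  assumes D: "D \<in> carrier_mat m n" and ev: "eigenvalue (D * transpose_mat D) e" and "e \<noteq> 0"
  shows "eigenvalue (transpose_mat D * D) e"
proof -
  let ?T = "transpose_mat D"
  have T: "?T \<in> carrier_mat n m" using D by simp
  from ev obtain v where v: "v \<in> carrier_vec m" "v \<noteq> 0\<^sub>v m" and Lv: "(D * ?T) *\<^sub>v v = e \<cdot>\<^sub>v v"
    unfolding eigenvalue_def eigenvector_def using D by auto
  define y where "y = ?T *\<^sub>v v"
  have y: "y \<in> carrier_vec n" using T v unfolding y_def by simp
  have Dy: "D *\<^sub>v y = e \<cdot>\<^sub>v v"
    unfolding y_def using Lv assoc_mult_mat_vec[OF D T v(1)] by simp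
  have "(?T * D) *\<^sub>v y = ?T *\<^sub>v (D *\<^sub>v y)" by (rule assoc_mult_mat_vec[OF T D y])
  also have "\<dots> = e \<cdot>\<^sub>v y" unfolding Dy unfolding y_def by (rule mult_mat_vec[OF T v(1)])
  finally have "(?T * D) *\<^sub>v y = e \<cdot>\<^sub>v y" .
  moreover have "y \<noteq> 0\<^sub>v n"
  proof
    assume "y = 0\<^sub>v n"
    moreover have "D *\<^sub>v 0\<^sub>v n = 0\<^sub>v m" using D by (intro eq_vecI) auto
    ultimately have ev0: "e \<cdot>\<^sub>v v = 0\<^sub>v m" using Dy by simp
    have "v $ i = 0" if "i < m" for i
      using arg_cong[OF ev0, of "\<lambda>w. w $ i"] that v \<open>e \<noteq> 0\<close> by simp
    then have "v = 0\<^sub>v m" using v by (intro eq_vecI) auto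
    with v show False by simp
  qed
  ultimately show ?thesis
    unfolding eigenvalue_def eigenvector_def using D y by (intro exI[of _ y]) auto
qed

text \<open>Compare both sides of the eigenvector equation at a coordinate of largest absolute
  value.\<close>

lemma eigenvalue_le_row_sum:
  fixes A :: "real mat"
  assumes A: "A \<in> carrier_mat n n" and ev: "eigenvalue A e"
    and row: "\<And>i. i < n \<Longrightarrow> (\<Sum>j<n. \<bar>A $$ (i, j)\<bar>) \<le> c"
  shows "e \<le> c"
proof -
  from ev obtain y where y: "y \<in> carrier_vec n" "y \<noteq> 0\<^sub>v n" and Ay: "A *\<^sub>v y = e \<cdot>\<^sub>v y"
    unfolding eigenvalue_def eigenvector_def using A by auto
  obtain p where p: "p < n" "y $ p \<noteq> 0"
    using y by (metis carrier_vecD eq_vecI index_zero_vec)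
  \<comment> \<open>A coordinate of maximal absolute value, obtained by minimizing the negated
    values.\<close>
  obtain i where "is_arg_min (\<lambda>j. - \<bar>y $ j\<bar>) (\<lambda>j. j \<in> {..<n}) i"
    using ex_is_arg_min_if_finite[of "{..<n}"] p by blast
  then have i: "i < n" and max: "\<And>j. j < n \<Longrightarrow> \<bar>y $ j\<bar> \<le> \<bar>y $ i\<bar>"
    by (auto simp: is_arg_min_linorder)
  have pos: "\<bar>y $ i\<bar> > 0" using max[OF p(1)] p(2) by linarith
  have "e * y $ i = (\<Sum>j<n. A $$ (i, j) * y $ j)"
    using arg_cong[OF Ay, of "\<lambda>w. w $ i"] i y
    unfolding index_mult_mat_vec_sum[OF A y(1) i] by simp
  then have "\<bar>e\<bar> * \<bar>y $ i\<bar> \<le> (\<Sum>j<n. \<bar>A $$ (i, j)\<bar> * \<bar>y $ j\<bar>)"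
    by (metis (no_types, lifting) abs_mult sum.cong sum_abs)
  also have "\<dots> \<le> (\<Sum>j<n. \<bar>A $$ (i, j)\<bar> * \<bar>y $ i\<bar>)"
    by (intro sum_mono mult_left_mono max) auto
  also have "\<dots> \<le> c * \<bar>y $ i\<bar>"
    using row[OF i] by (simp add: sum_distrib_right[symmetric] mult_right_mono)
  finally show ?thesis using pos by (simp add: mult_le_cancel_right)
qed

section \<open>Facets and ridges\<close>

lemma distinct_subset_list: "distinct (subset_list n)"
  unfolding subset_list_def by (rule distinct_set_subseqs) simp

lemma set_subset_list: "set (subset_list n) = Pow {1..n}"
  unfolding subset_list_def set_map subseqs_powset
  by (simp only: set_upt atLeastLessThanSuc_atLeastAtMost)

lemma distinct_facet_list: "distinct (facet_list n S)"
  unfolding facet_list_def by (simp add: distinct_subset_list)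

lemma distinct_ridge_list: "distinct (ridge_list n k)"
  unfolding ridge_list_def by (simp add: distinct_subset_list)

lemma set_facet_list:
  assumes "k_family n k S"
  shows "set (facet_list n S) = S"
  using assms unfolding facet_list_def k_family_def by (auto simp: set_subset_list)

lemma length_facet_list:
  assumes "k_family n k S"
  shows "length (facet_list n S) = card S"
  using distinct_card[OF distinct_facet_list[of n S]] set_facet_list[OF assms] by simp

lemma abs_boundary_entry_le_1: "\<bar>boundary_entry G F\<bar> \<le> 1"
  unfolding boundary_entry_def by (simp add: power_abs)

lemma boundary_entry_nonzeroD:
  assumes "boundary_entry G F \<noteq> 0"
  shows "\<exists>x\<in>F. G = F - {x}"
proof -
  obtain j where j: "j < card F" "G = F - {sorted_list_of_set F ! j}"
    using assms unfolding boundary_entry_def by (auto split: if_splits)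
  \<comment> \<open>An infinite set has cardinality 0 by convention, which \<open>j < card F\<close>
    excludes.\<close>
  then have "finite F" using card.infinite by fastforce
  then have "sorted_list_of_set F ! j \<in> F"
    using j by (metis nth_mem set_sorted_list_of_set sorted_list_of_set.length_sorted_key_list_of_set)
  with j show ?thesis by blast
qed

text \<open>Here \<open>T\<close> is any finite set containing the ridges common to \<open>F\<close>
  and \<open>F'\<close>; each of them contributes at most 1 in absolute value.\<close>

lemma sum_abs_boundary_products_le:
  assumes "finite R" "finite T"
    and "\<And>G. G \<in> R \<Longrightarrow> boundary_entry G F \<noteq> 0 \<Longrightarrow> boundary_entry G F' \<noteq> 0 \<Longrightarrow> G \<in> T"
  shows "\<bar>\<Sum>G\<in>R. boundary_entry G F * boundary_entry G F'\<bar> \<le> real (card T)"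
proof -
  let ?g = "\<lambda>G. boundary_entry G F * boundary_entry G F'"
  have "\<bar>?g G\<bar> \<le> (if G \<in> T then 1 else 0)" if "G \<in> R" for G
  proof (cases "G \<in> T")
    case True
    have "\<bar>boundary_entry G F\<bar> * \<bar>boundary_entry G F'\<bar> \<le> 1 * 1"
      by (intro mult_mono abs_boundary_entry_le_1) auto
    with True show ?thesis by (simp add: abs_mult)
  next
    case False
    then show ?thesis using assms(3)[OF that] by auto
  qed
  then have "(\<Sum>G\<in>R. \<bar>?g G\<bar>) \<le> (\<Sum>G\<in>R. if G \<in> T then 1 else 0)" by (intro sum_mono)
  also have "\<dots> = real (card (R \<inter> T))" using assms(1) by (simp add: sum.If_cases Int_def)
  also have "\<dots> \<le> real (card T)" using assms(2) by (simp add: card_mono)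
  finally show ?thesis using sum_abs[of ?g R] by linarith
qed

text \<open>The off-diagonal bound holds because two distinct facets of the same size share at most one
  ridge, namely their intersection.\<close>

lemma gram_boundary_bound:
  assumes fam: "k_family n k S" and i: "i < card S" and j: "j < card S"
  shows "\<bar>(transpose_mat (boundary_mat n k S) * boundary_mat n k S) $$ (i, j)\<bar>
    \<le> (if i = j then real k else 1)"
proof -
  define R where "R = ridge_list n k"
  define F where "F = facet_list n S ! i"
  define F' where "F' = facet_list n S ! j"
  note len = length_facet_list[OF fam]
  have "F \<in> S" "F' \<in> S"
    using i j len set_facet_list[OF fam] unfolding F_def F'_def by (metis nth_mem)+
  then have F: "finite F" "card F = k" and F': "finite F'" "card F' = k"
    using fam unfolding k_family_def by (meson finite_atLeastAtMost finite_subset)+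
  have "(transpose_mat (boundary_mat n k S) * boundary_mat n k S) $$ (i, j)
      = (\<Sum>l<length R. boundary_entry (R ! l) F * boundary_entry (R ! l) F')"
    using i j len unfolding boundary_mat_def R_def F_def F'_def
    by (subst index_mult_mat_sum[of _ "card S" "length (ridge_list n k)" _ "card S"]) auto
  also have "\<dots> = (\<Sum>G\<leftarrow>R. boundary_entry G F * boundary_entry G F')"
    by (simp add: sum_list_sum_nth atLeast0LessThan)
  also have "\<dots> = (\<Sum>G\<in>set R. boundary_entry G F * boundary_entry G F')"
    unfolding R_def by (rule sum_list_distinct_conv_sum_set[OF distinct_ridge_list])
  finally have eq: "(transpose_mat (boundary_mat n k S) * boundary_mat n k S) $$ (i, j) = \<dots>" .
  show ?thesis
  proof (cases "i = j")
    case True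
    \<comment> \<open>On the diagonal the common ridges are those of \<open>F\<close> itself, one
      per deleted vertex, so at most \<open>k\<close>.\<close>
    have "\<bar>\<Sum>G\<in>set R. boundary_entry G F * boundary_entry G F'\<bar> \<le> real (card ((\<lambda>x. F - {x}) ` F))"
      using F by (intro sum_abs_boundary_products_le) (auto dest: boundary_entry_nonzeroD)
    also have "\<dots> \<le> real k" using F card_image_le[of F "\<lambda>x. F - {x}"] by simp
    finally show ?thesis using eq True by simp
  next
    case False
    then have ne: "F \<noteq> F'"
      using i j len distinct_facet_list[of n S] unfolding F_def F'_def
      by (simp add: nth_eq_iff_index_eq)
    have "\<bar>\<Sum>G\<in>set R. boundary_entry G F * boundary_entry G F'\<bar> \<le> real (card {F \<inter> F'})"
    proof (intro sum_abs_boundary_products_le)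
      fix G assume "boundary_entry G F \<noteq> 0" "boundary_entry G F' \<noteq> 0"
      then obtain x y where x: "x \<in> F" "G = F - {x}" and y: "y \<in> F'" "G = F' - {y}"
        by (auto dest!: boundary_entry_nonzeroD)
      \<comment> \<open>If \<open>x\<close> were in \<open>F'\<close>, then \<open>x = y\<close>, as
        \<open>x\<close> is missing from \<open>G\<close>; adding it back to \<open>G\<close> would
        give \<open>F = F'\<close>.\<close>
      have "x \<notin> F'"
        using x y ne by blast
      then show "G \<in> {F \<inter> F'}" using x y by blast
    qed auto
    then show ?thesis using eq False by simp
  qed
qed

lemma boundary_mat_carrier:
  assumes "k_family n k S"
  shows "boundary_mat n k S \<in> carrier_mat (length (ridge_list n k)) (card S)"
  using length_facet_list[OF assms] unfolding boundary_mat_def by simp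

section \<open>Bounds on the Laplacian eigenvalues\<close>

lemma sum_squares_laplacian_spectrum_le:
  assumes fam: "k_family n k S"
  shows "(\<Sum>x\<leftarrow>eigenvalue_list (laplacian n k S). x\<^sup>2)
    \<le> real (card S) * ((real k)\<^sup>2 + real (card S) - 1)"
proof -
  let ?D = "boundary_mat n k S"
  let ?f = "card S"
  note D = boundary_mat_carrier[OF fam]
  have "(\<Sum>x\<leftarrow>eigenvalue_list (laplacian n k S). x\<^sup>2)
      = mat_trace ((?D * transpose_mat ?D) * (?D * transpose_mat ?D))"
    unfolding laplacian_def using D
    by (intro sum_squares_eigenvalue_list) (auto simp: transpose_mult[OF D, of "transpose_mat ?D"])
  also have "\<dots> = (\<Sum>i<?f. \<Sum>j<?f. ((transpose_mat ?D * ?D) $$ (i, j))\<^sup>2)"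
    by (rule mat_trace_gram_square[OF D])
  \<comment> \<open>The entrywise bound is written as the constant 1 plus a diagonal correction, so
    that the double sum evaluates directly.\<close>
  also have "\<dots> \<le> (\<Sum>i<?f. \<Sum>j<?f. 1 + (if i = j then (real k)\<^sup>2 - 1 else 0))"
  proof (intro sum_mono)
    fix i j assume "i \<in> {..<?f}" "j \<in> {..<?f}"
    then have "\<bar>(transpose_mat ?D * ?D) $$ (i, j)\<bar> \<le> (if i = j then real k else 1)"
      using gram_boundary_bound[OF fam] by simp
    from power_mono[OF this, of 2]
    show "((transpose_mat ?D * ?D) $$ (i, j))\<^sup>2 \<le> 1 + (if i = j then (real k)\<^sup>2 - 1 else 0)"
      by (simp split: if_splits)
  qed
  also have "\<dots> = (\<Sum>i<?f. real ?f + ((real k)\<^sup>2 - 1))"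
    by (intro sum.cong) (auto simp: sum.distrib)
  also have "\<dots> = real ?f * ((real k)\<^sup>2 + real ?f - 1)" by (simp add: algebra_simps)
  finally show ?thesis .
qed

text \<open>Indices beyond the spectrum contribute the default value 0, and the remaining terms are
  part of a sum of squares.\<close>

lemma sum_squares_laplacian_eigenvalues_le:
  assumes fam: "k_family n k S"
  shows "(\<Sum>i=1..t. (laplacian_eigenvalue n k S i)\<^sup>2)
    \<le> real (card S) * ((real k)\<^sup>2 + real (card S) - 1)"
proof -
  define ls where "ls = eigenvalue_list (laplacian n k S)"
  have "(\<Sum>i=1..t. (laplacian_eigenvalue n k S i)\<^sup>2)
      = (\<Sum>i<t. if i < length ls then (ls ! i)\<^sup>2 else 0)"
    unfolding laplacian_eigenvalue_def ls_def[symmetric] Let_def One_nat_def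
    by (subst sum.atLeast1_atMost_eq) (intro sum.cong, auto simp: Suc_le_eq)
  also have "\<dots> = (\<Sum>i\<in>{..<t} \<inter> {..<length ls}. (ls ! i)\<^sup>2)"
    by (simp add: sum.If_cases lessThan_def)
  also have "\<dots> \<le> (\<Sum>i<length ls. (ls ! i)\<^sup>2)" by (intro sum_mono2) auto
  also have "\<dots> = (\<Sum>x\<leftarrow>ls. x\<^sup>2)" by (simp add: sum_list_sum_nth atLeast0LessThan)
  finally show ?thesis using sum_squares_laplacian_spectrum_le[OF fam] unfolding ls_def by linarith
qed

lemma laplacian_eigenvalue_le:
  assumes fam: "k_family n k S"
  shows "laplacian_eigenvalue n k S 1 \<le> real k + real (card S) - 1"
proof -
  let ?D = "boundary_mat n k S"
  let ?L = "laplacian n k S"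
  let ?e = "laplacian_eigenvalue n k S 1"
  note D = boundary_mat_carrier[OF fam]
  have L: "?L \<in> carrier_mat (length (ridge_list n k)) (length (ridge_list n k))"
    unfolding laplacian_def using D by simp
  have "S \<noteq> {}" "finite S"
    using fam set_facet_list[OF fam] unfolding k_family_def by (auto, metis finite_set)
  then have f: "card S \<ge> 1" by (simp add: Suc_le_eq card_gt_0_iff)
  show ?thesis
  \<comment> \<open>Zero covers both the default value for an empty spectrum and the one eigenvalue
    that does not transfer between the two Gram matrices.\<close>
  proof (cases "?e = 0")
    case True
    then show ?thesis using f by simp
  next
    case False
    then have "?e \<in> set (eigenvalue_list ?L)"
      unfolding laplacian_eigenvalue_def by (auto simp: Let_def Suc_le_eq split: if_splits)
    then have "poly (char_poly ?L) ?e = 0"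
      using degree_monic_char_poly[OF L] unfolding eigenvalue_list_def
      by (cases "char_poly ?L = 0") auto
    then have "eigenvalue (?D * transpose_mat ?D) ?e"
      using eigenvalue_root_char_poly[OF L] unfolding laplacian_def by simp
    then have ev: "eigenvalue (transpose_mat ?D * ?D) ?e"
      using eigenvalue_gram_transpose[OF D] False by blast
    show ?thesis
    proof (rule eigenvalue_le_row_sum[OF _ ev])
      show "transpose_mat ?D * ?D \<in> carrier_mat (card S) (card S)" using D by simp
      fix i assume i: "i < card S"
      have "(\<Sum>j<card S. \<bar>(transpose_mat ?D * ?D) $$ (i, j)\<bar>)
          \<le> (\<Sum>j<card S. 1 + (if i = j then real k - 1 else 0))"
        by (intro sum_mono order_trans[OF gram_boundary_bound[OF fam i]]) auto
      also have "\<dots> = real k + real (card S) - 1" using i by (simp add: sum.distrib)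
      finally show "(\<Sum>j<card S. \<bar>(transpose_mat ?D * ?D) $$ (i, j)\<bar>) \<le> real k + real (card S) - 1" .
    qed
  qed
qed

section \<open>The binomial estimate and the final inequality\<close>

text \<open>This makes the linear coefficient in \<open>f\<close> nonnegative. Equality holds at
  \<open>t = 2\<close>; from \<open>t\<close> to \<open>t + 1\<close> the left side grows by
  \<open>k + 1\<close>, while by Pascal's rule the right side grows by at least
  \<open>2 * k\<close>.\<close>

lemma mult_Suc_le_two_choose:
  assumes "2 \<le> t" "2 \<le> k"
  shows "t * (k + 1) \<le> 2 * ((t + k - 1) choose k)"
  using assms(1)
proof (induction t rule: dec_induct)
  case base
  have "(2 + k - 1) choose k = k + 1" by (simp add: numeral_2_eq_2)
  then show ?case by simp
next
  case (step t)
  obtain m where m: "k = Suc m" using assms(2) by (cases k) auto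
  have "k = k choose m" unfolding m by simp
  also have "\<dots> \<le> (t + m) choose m" using step unfolding m by (intro binomial_right_mono) simp
  finally show ?case using step.IH assms(2) unfolding m by simp
qed

theorem theorem29:
  fixes n k t :: nat and S :: "nat set set"
  assumes "k \<ge> 2"
    and "0 < t" and "t < k"
    and "k_family n k S"
    and "matching_number k S > t"
  shows "(\<Sum>i=1..t. laplacian_eigenvalue n k S i)
    \<le> (real k - 1) * real (card S) + real ((t + k - 1) choose k)"
proof (cases "t = 1")
  case True
  have "finite S" "S \<noteq> {}"
    using assms(4) set_facet_list[OF assms(4)] unfolding k_family_def by (metis finite_set, simp)
  \<comment> \<open>For \<open>t = 1\<close> the binomial is 1, and this product is exactly the
    claimed bound minus \<open>k + f - 1\<close>.\<close>
  then have "0 \<le> (real k - 2) * (real (card S) - 1)"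
    using assms(1) by (intro mult_nonneg_nonneg) (auto simp: Suc_le_eq card_gt_0_iff)
  then show ?thesis
    using laplacian_eigenvalue_le[OF assms(4)] True by (simp add: algebra_simps)
next
  case False
  define T where "T = real t"
  define K where "K = real k"
  define f where "f = real (card S)"
  define C where "C = real ((t + k - 1) choose k)"
  define a where "a = laplacian_eigenvalue n k S"
  have "real (t * (k + 1)) \<le> real (2 * ((t + k - 1) choose k))"
    using mult_Suc_le_two_choose[of t k] assms False by (intro of_nat_mono) simp
  then have TC: "T * (K + 1) \<le> 2 * C" by (simp add: T_def K_def C_def algebra_simps)
  have TK: "0 \<le> T" "T \<le> K - 1" "1 \<le> K - 1" "0 \<le> f" "0 \<le> C"
    using assms by (auto simp: T_def K_def f_def C_def)
  \<comment> \<open>From \<open>T \<le> K - 1\<close> and \<open>1 \<le> K - 1\<close>; this settles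
    the coefficient of the square of \<open>f\<close>.\<close>
  have "T * 1 \<le> (K - 1) * (K - 1)" using TK by (intro mult_mono) auto
  then have "0 \<le> ((K - 1)\<^sup>2 - T) * f\<^sup>2" by (simp add: power2_eq_square)
  moreover have "0 \<le> (K - 1) * (2 * C - T * (K + 1)) * f" using TK TC by simp
  moreover have "((K - 1) * f + C)\<^sup>2 - T * (f * (K\<^sup>2 + f - 1))
      = ((K - 1)\<^sup>2 - T) * f\<^sup>2 + (K - 1) * (2 * C - T * (K + 1)) * f + C\<^sup>2"
    by (simp add: power2_eq_square algebra_simps)
  ultimately have le: "T * (f * (K\<^sup>2 + f - 1)) \<le> ((K - 1) * f + C)\<^sup>2"
    using zero_le_power2[of C] by linarith
  \<comment> \<open>Cauchy-Schwarz against the all-ones vector of length \<open>t\<close>, whose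
    squared norm is the factor \<open>T\<close>.\<close>
  have "(\<Sum>i=1..t. a i * 1)\<^sup>2 \<le> (\<Sum>i=1..t. (a i)\<^sup>2) * (\<Sum>i=1..t. 1\<^sup>2)"
    by (rule Cauchy_Schwarz_ineq_sum)
  then have "(\<Sum>i=1..t. a i)\<^sup>2 \<le> T * (\<Sum>i=1..t. (a i)\<^sup>2)" by (simp add: T_def mult.commute)
  also have "\<dots> \<le> T * (f * (K\<^sup>2 + f - 1))"
    using sum_squares_laplacian_eigenvalues_le[OF assms(4), of t] TK
    unfolding a_def f_def K_def by (intro mult_left_mono) auto
  also note le
  finally have "(\<Sum>i=1..t. a i) \<le> (K - 1) * f + C"
    using TK by (intro power2_le_imp_le[OF _ add_nonneg_nonneg]) auto
  then show ?thesis by (simp add: a_def K_def f_def C_def)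
qed

end
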